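(* Let $R$ be a Hermitian operator on $\mathbb{C}^M$ which in an orthonormal eigenbasis has matrix $\operatorname{diag}(\lambda_1,\ldots,\lambda_M)$, and let $\mathbf{P}_\sigma$, $\sigma\in S_M$, be the operator whose matrix in that eigenbasis is the permutation matrix of $\sigma$. Then $$\|[\mathbf{P}_\sigma,R]\|_F^2=\sum_{k=1}^{M}(\lambda_k-\lambda_{\sigma(k)})^2 .$$
   Context: $[X,Y]=XY-YX$; $\|\cdot\|_F$ is the Frobenius norm. *)

theory Defs
  imports "HOL-Analysis.Analysis"
begin

(* Operators on C^M are complex-linear maps on complex^'n with CARD('n) = M. The inner product on
   complex^'n in HOL-Analysis is the real one, so the Hermitian inner product is defined here;
   it is conjugate-linear in the first argument. *)

definition cinner :: "complex ^ 'n \<Rightarrow> complex ^ 'n \<Rightarrow> complex"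
  where "cinner x y = (\<Sum>i\<in>UNIV. cnj (x $ i) * y $ i)"

definition clinear_op :: "(complex ^ 'n \<Rightarrow> complex ^ 'n) \<Rightarrow> bool"
  where "clinear_op f \<longleftrightarrow> Vector_Spaces.linear (*s) (*s) f"

definition hermitian_op :: "(complex ^ 'n \<Rightarrow> complex ^ 'n) \<Rightarrow> bool"
  where "hermitian_op f \<longleftrightarrow> clinear_op f \<and> (\<forall>x y. cinner (f x) y = cinner x (f y))"

definition orthonormal_basis :: "('n \<Rightarrow> complex ^ 'n) \<Rightarrow> bool"
  where "orthonormal_basis b \<longleftrightarrow>
    (\<forall>i j. cinner (b i) (b j) = (if i = j then 1 else 0)) \<and> vec.span (range b) = UNIV"

(* Column j of A holds the coordinates of f (b j). *)
definition has_matrix_in ::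
    "(complex ^ 'n \<Rightarrow> complex ^ 'n) \<Rightarrow> ('n \<Rightarrow> complex ^ 'n) \<Rightarrow> complex ^ 'n ^ 'n \<Rightarrow> bool"
  where "has_matrix_in f b A \<longleftrightarrow> (\<forall>j. f (b j) = (\<Sum>i\<in>UNIV. (A $ i $ j) *s b i))"

definition diag_matrix :: "('n \<Rightarrow> complex) \<Rightarrow> complex ^ 'n ^ 'n"
  where "diag_matrix d = (\<chi> i j. if i = j then d i else 0)"

(* Convention: the permutation matrix sends the k-th coordinate vector to the (\<sigma> k)-th. *)
definition perm_matrix :: "('n \<Rightarrow> 'n) \<Rightarrow> complex ^ 'n ^ 'n"
  where "perm_matrix \<sigma> = (\<chi> i j. if i = \<sigma> j then 1 else 0)"

definition commutator ::
    "(complex ^ 'n \<Rightarrow> complex ^ 'n) \<Rightarrow> (complex ^ 'n \<Rightarrow> complex ^ 'n) \<Rightarrow> complex ^ 'n \<Rightarrow> complex ^ 'n"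
  where "commutator X Y = (\<lambda>v. X (Y v) - Y (X v))"

(* "matrix f" is the matrix of f in the standard basis of C^M. *)
definition frobenius_norm :: "(complex ^ 'n \<Rightarrow> complex ^ 'n) \<Rightarrow> real"
  where "frobenius_norm f = sqrt (\<Sum>i\<in>UNIV. \<Sum>j\<in>UNIV. (cmod (matrix f $ i $ j))\<^sup>2)"

lemma frobenius_norm_eq_norm_matrix: "frobenius_norm f = norm (matrix f)"
  by (simp add: frobenius_norm_def norm_vec_def L2_set_def sum_nonneg)

end

(* The Frobenius norm may be computed in any orthonormal basis. In the eigenbasis b,
   [P, R] maps b_k to (lam_k - lam_(sigma k)) b_(sigma k), and the lam_k are real because R is Hermitian. *)

theory Submission
  imports Defs
begin

text \<open>The squared Frobenius norm of f is the sum of the squared lengths of the f (b k) for any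
  orthonormal basis b (\<open>frobenius_norm_orthonormal_basis\<close>), so it can be read off in
  the eigenbasis. There the commutator sends each basis vector to a multiple of a unit vector, and
  only the squared modulus of the coefficient survives. It is a plain square because Hermitian
  symmetry makes the eigenvalues real.\<close>

lemma cinner_scale_left: "cinner (c *s x) y = cnj c * cinner x y"
  by (simp add: cinner_def sum_distrib_left mult.assoc)

lemma cinner_scale_right: "cinner x (c *s y) = c * cinner x y"
  by (simp add: cinner_def sum_distrib_left mult.left_commute)

text \<open>Let B have the columns b k. Orthonormality says that the adjoint of B is a left inverse;
  for square matrices it is then also a right inverse, which read entrywise is this completeness
  relation.\<close>

lemma orthonormal_basis_complete:
  fixes b :: "'n \<Rightarrow> complex ^ 'n"
  assumes "orthonormal_basis b"
  shows "(\<Sum>k\<in>UNIV. b k $ i * cnj (b k $ j)) = (if i = j then 1 else 0)"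
proof -
  define B :: "complex ^ 'n ^ 'n" where "B = (\<chi> i k. b k $ i)"
  define B' :: "complex ^ 'n ^ 'n" where "B' = (\<chi> k i. cnj (b k $ i))"
  have "B' ** B = mat 1"
    using assms
    by (simp add: orthonormal_basis_def cinner_def B_def B'_def matrix_matrix_mult_def mat_def vec_eq_iff)
  then have "B ** B' = mat 1"
    using matrix_left_right_inverse by blast
  then have "(B ** B') $ i $ j = mat 1 $ i $ j"
    by simp
  then show ?thesis
    by (simp add: B_def B'_def matrix_matrix_mult_def mat_def)
qed

text \<open>This is invariance of the Frobenius norm under A \<mapsto> A B for unitary B. The
  equation lives in the complex numbers because \<open>cinner\<close> is complex-valued.\<close>

lemma frobenius_norm_orthonormal_basis:
  fixes f :: "complex ^ 'n \<Rightarrow> complex ^ 'n"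
  assumes f: "clinear_op f" and b: "orthonormal_basis b"
  shows "complex_of_real ((frobenius_norm f)\<^sup>2) = (\<Sum>k\<in>UNIV. cinner (f (b k)) (f (b k)))"
proof -
  define A where "A = matrix f"
  have fA: "f x $ i = (\<Sum>j\<in>UNIV. A $ i $ j * x $ j)" for x i
  proof -
    have "A *v x = f x"
      using f by (simp add: A_def clinear_op_def matrix_works)
    then have "f x $ i = (A *v x) $ i"
      by simp
    then show ?thesis
      by (simp add: matrix_vector_mult_def)
  qed
  \<comment> \<open>Multiplying by the unitary B on the right preserves the length of each row of A
    separately.\<close>
  have row: "(\<Sum>k\<in>UNIV. cnj (f (b k) $ i) * f (b k) $ i) = (\<Sum>j\<in>UNIV. A $ i $ j * cnj (A $ i $ j))" for i
  proof -
    have "(\<Sum>k\<in>UNIV. cnj (f (b k) $ i) * f (b k) $ i)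
        = (\<Sum>k\<in>UNIV. \<Sum>l\<in>UNIV. \<Sum>j\<in>UNIV. cnj (A $ i $ l) * A $ i $ j * (b k $ j * cnj (b k $ l)))"
      by (simp only: fA cnj_sum complex_cnj_mult sum_product) (simp add: mult_ac)
    \<comment> \<open>Two swaps move the sum over k innermost, where completeness turns it into a
      Kronecker delta.\<close>
    also have "\<dots> = (\<Sum>l\<in>UNIV. \<Sum>k\<in>UNIV. \<Sum>j\<in>UNIV. cnj (A $ i $ l) * A $ i $ j * (b k $ j * cnj (b k $ l)))"
      by (rule sum.swap)
    also have "\<dots> = (\<Sum>l\<in>UNIV. \<Sum>j\<in>UNIV. \<Sum>k\<in>UNIV. cnj (A $ i $ l) * A $ i $ j * (b k $ j * cnj (b k $ l)))"
      by (intro sum.cong refl sum.swap)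
    also have "\<dots> = (\<Sum>l\<in>UNIV. \<Sum>j\<in>UNIV. cnj (A $ i $ l) * A $ i $ j * (if j = l then 1 else 0))"
      by (simp only: sum_distrib_left[symmetric] orthonormal_basis_complete[OF b])
    also have "\<dots> = (\<Sum>j\<in>UNIV. A $ i $ j * cnj (A $ i $ j))"
      by (simp add: if_distrib cong: if_cong) (simp add: mult.commute)
    finally show ?thesis .
  qed
  have "complex_of_real ((frobenius_norm f)\<^sup>2) = (\<Sum>i\<in>UNIV. \<Sum>j\<in>UNIV. A $ i $ j * cnj (A $ i $ j))"
    by (simp add: frobenius_norm_def A_def sum_nonneg flip: complex_norm_square)
  also have "\<dots> = (\<Sum>i\<in>UNIV. \<Sum>k\<in>UNIV. cnj (f (b k) $ i) * f (b k) $ i)"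
    by (simp only: row)
  also have "\<dots> = (\<Sum>k\<in>UNIV. cinner (f (b k)) (f (b k)))"
    unfolding cinner_def by (rule sum.swap)
  finally show ?thesis .
qed

lemma clinear_op_commutator:
  assumes "clinear_op X" "clinear_op Y"
  shows "clinear_op (commutator X Y)"
  using vec.linear_compose_sub[OF
      Vector_Spaces.linear_compose[of "(*s)" "(*s)" Y "(*s)" X]
      Vector_Spaces.linear_compose[of "(*s)" "(*s)" X "(*s)" Y]] assms
  by (simp add: clinear_op_def commutator_def o_def)

lemma has_matrix_in_diag_matrix:
  "has_matrix_in f b (diag_matrix d) \<longleftrightarrow> (\<forall>k. f (b k) = d k *s b k)"
  by (simp add: has_matrix_in_def diag_matrix_def if_distrib[of "\<lambda>c. c *s _"] cong: if_cong)

lemma has_matrix_in_perm_matrix: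
  "has_matrix_in f b (perm_matrix \<sigma>) \<longleftrightarrow> (\<forall>k. f (b k) = b (\<sigma> k))"
  by (simp add: has_matrix_in_def perm_matrix_def if_distrib[of "\<lambda>c. c *s _"] cong: if_cong)

theorem corollary10p2:
  fixes R P :: "complex ^ 'n \<Rightarrow> complex ^ 'n"
    and b :: "'n \<Rightarrow> complex ^ 'n"
    and lam :: "'n \<Rightarrow> complex"
    and \<sigma> :: "'n \<Rightarrow> 'n"
  assumes "hermitian_op R"
    and "orthonormal_basis b"
    and "has_matrix_in R b (diag_matrix lam)"
    and "\<sigma> permutes UNIV"
    and "clinear_op P"
    and "has_matrix_in P b (perm_matrix \<sigma>)"
  shows "complex_of_real ((frobenius_norm (commutator P R))\<^sup>2) = (\<Sum>k\<in>UNIV. (lam k - lam (\<sigma> k))\<^sup>2)"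
proof -
  have R: "R (b k) = lam k *s b k" and P: "P (b k) = b (\<sigma> k)" for k
    using assms(3,6) by (simp_all add: has_matrix_in_diag_matrix has_matrix_in_perm_matrix)
  have unit: "cinner (b k) (b k) = 1" for k
    using assms(2) by (simp add: orthonormal_basis_def)
  have "clinear_op R"
    using assms(1) by (simp add: hermitian_op_def)
  \<comment> \<open>Hermitian symmetry is tested on the unit eigenvector b k against itself.\<close>
  have real: "cnj (lam k) = lam k" for k
  proof -
    have "cinner (R (b k)) (b k) = cinner (b k) (R (b k))"
      using assms(1) by (simp add: hermitian_op_def)
    then show ?thesis
      by (simp add: R cinner_scale_left cinner_scale_right unit)
  qed
  \<comment> \<open>Linearity of P pulls lam k out of P (R (b k)), while R (P (b k)) picks up the
    eigenvalue of b (\<sigma> k).\<close>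
  have comm: "commutator P R (b k) = (lam k - lam (\<sigma> k)) *s b (\<sigma> k)" for k
    using assms(5)
    by (simp add: commutator_def R P clinear_op_def vec.linear_scale vec.scale_left_diff_distrib)
  \<comment> \<open>Each summand is cnj c * c with c = lam k - lam (\<sigma> k) real. The
    distributivity rules are removed to keep c a single scalar, so that the scaling lemmas for
    \<open>cinner\<close> apply.\<close>
  show ?thesis
    unfolding frobenius_norm_orthonormal_basis[OF clinear_op_commutator[OF assms(5) \<open>clinear_op R\<close>] assms(2)]
    by (simp add: comm cinner_scale_left cinner_scale_right unit real power2_eq_square
        del: vec.scale_left_diff_distrib vector_sub_rdistrib)
qed

end
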